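(* Let the non-colluders be partitioned as $\mathsf N=\mathsf N_T\cup\mathsf N_F$ (correctly and incorrectly classified) and the colluders as $\mathsf C=\mathsf C_T\cup\mathsf C_F$ (correctly and incorrectly classified). Suppose C-PoP using the DP oracle is applied with the predicted set of non-colluders $\widehat{\mathsf N}=\mathsf N_T\cup\mathsf C_F$ and the predicted set of colluders $\widehat{\mathsf C}=\mathsf N_F\cup\mathsf C_T$. Then C-PoP remains (ex-post) dominant strategy incentive compatible for all non-colluders: for every $i\in\mathsf N=\mathsf N_T\cup\mathsf N_F$, every valuation $v_i$ and every bids of all other bidders, bidding $b_i=v_i$ maximizes bidder $i$'s utility. Moreover, if $|\mathsf N_T|\ge r+1$, then the posted price satisfies $p^*\ge b^{\mathsf N_T}_{r+1}$, where $b^{\mathsf N_T}_{r+1}$ is the $(r+1)$-st largest bid among the bidders in $\mathsf N_T$.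
   Context: Setting: $r$ identical items, single-minded bidders. Bidder $i$ has valuation $v_i\ge0$ and bid $b_i\ge0$; the mechanism outputs $x_i\in\{0,1\}$ and payments $p_i$; a non-colluder's utility is $u_i=v_ix_i-p_i$ (in expectation over the mechanism's random selection of winners, if any). Notation for the set $\widehat{\mathsf N}$ the mechanism treats as non-colluders, $\hat n=|\widehat{\mathsf N}|$: $b^{\widehat{\mathsf N}}_k$ is the $k$-th largest bid in $\widehat{\mathsf N}$ ($0$ if $k>\hat n$); $\overline{\mathsf B_k}=\{b^{\widehat{\mathsf N}}_{k+1},\dots,b^{\widehat{\mathsf N}}_{\hat n}\}$; $\overline{\mathcal B_k}$ is the corresponding random object under a prior distribution for the bids used by the auctioneer. DP oracle: takes the bids of $\widehat{\mathsf N}$, the numbers $|\widehat{\mathsf N}|,|\widehat{\mathsf C}|$, and a given real objective function $M(p,\overline{\mathsf B_k})$ (depending on the bids only through $\overline{\mathsf B_k}$). For $k=0,\dots,r$ let $p_k\in\arg\max_{p\ge b^{\widehat{\mathsf N}}_{k+1}}M(p,\overline{\mathsf B_k})$ (maximizers assumed to exist, ties broken by a fixed rule). Value functions: $V(p_0,\overline{\mathcal B_0})=M(p_0,\overline{\mathcal B_0})$ and, for $k=1,\dots,r$, $V(p_k,\overline{\mathcal B_k})=\max\{M(p_k,\overline{\mathcal B_k}),\ \mathbb E[V(p_{k-1},\overline{\mathcal B_{k-1}})\mid\overline{\mathcal B_k}]\}$. Then, starting from $k^*=r$, while $k^*\ge1$ and $M(p_{k^*},\overline{\mathsf B_{k^*}})<\mathbb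 E[V(p_{k^*-1},\overline{\mathcal B_{k^*-1}})\mid\overline{\mathsf B_{k^*}}]$, decrease $k^*$ by $1$. Output $k^*$ and $p^*=p_{k^*}$. C-PoP mechanism: compute $(k^*,p^* )$ from the oracle. Phase 1: the bidders in $\widehat{\mathsf N}$ with $b_i>p^*$ qualify; if more than $r$ qualify, $r$ of them chosen at random win, otherwise all win; let $w$ be the number of these winners. Phase 2: the bidders in $\widehat{\mathsf C}$ with $b_i>p^*$ qualify; if more than $\max\{r-w,0\}$ qualify, a uniformly random subset of that size wins, otherwise all win. Each winner gets one item and pays $p^*$; losers get nothing and pay $0$. *)

theory Defs
  imports "HOL-Probability.Probability"
begin

section \<open>Order statistics of the bids\<close>

text \<open>The \<open>k\<close>-th largest (\<open>k \<ge> 1\<close>) of the bids \<open>b\<close> of the bidders in the finite set \<open>S\<close>.\<close>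

definition kth_largest :: "'b set \<Rightarrow> ('b \<Rightarrow> real) \<Rightarrow> nat \<Rightarrow> real" where
  "kth_largest S b k =
     (if k \<le> card S
      then rev (sorted_list_of_multiset (image_mset b (mset_set S))) ! (k - 1)
      else 0)"

text \<open>The collection of the bids of rank \<open>k+1, \<dots>, |S|\<close>, encoded as the family of these bids indexed
  by their rank, i.e. as an element of \<open>\<real>\<^bsup>{k+1..|S|}\<^esup>\<close>.  It carries the same information as the
  multiset of these bids.  For \<open>k \<ge> |S|\<close> it is the unique element of the empty product.\<close>

definition low_bids :: "'b set \<Rightarrow> ('b \<Rightarrow> real) \<Rightarrow> nat \<Rightarrow> nat \<Rightarrow> real" where
  "low_bids S b k = restrict (kth_largest S b) {k<..card S}"

abbreviation low_bids_space :: "'b set \<Rightarrow> nat \<Rightarrow> (nat \<Rightarrow> real) measure" where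
  "low_bids_space S k \<equiv> Pi\<^sub>M {k<..card S} (\<lambda>_. borel)"


section \<open>The DP oracle\<close>

text \<open>Throughout, \<open>M p B\<close> is the objective.  The numbers of predicted non-colluders and colluders are
  constants of the instance, so that a dependence of the objective on them is absorbed in \<open>M\<close>.

  A price rule \<open>pr\<close> selects, for each \<open>k\<close> and each possible value \<open>B\<close> of the low bids, one maximizer
  \<open>p\<^sub>k = pr k B\<close>.  That \<open>pr\<close> is a function of \<open>k\<close> and \<open>B\<close> expresses the fixed tie-breaking.\<close>

definition price_rule ::
  "nat \<Rightarrow> 'b set \<Rightarrow> (real \<Rightarrow> (nat \<Rightarrow> real) \<Rightarrow> real) \<Rightarrow> (nat \<Rightarrow> (nat \<Rightarrow> real) \<Rightarrow> real) \<Rightarrow> bool" where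
  "price_rule r S M pr \<longleftrightarrow>
     (\<forall>k\<le>r. \<forall>b. (\<forall>i\<in>S. 0 \<le> b i) \<longrightarrow>
        is_arg_max (\<lambda>p. M p (low_bids S b k)) (\<lambda>p. kth_largest S b (k + 1) \<le> p)
          (pr k (low_bids S b k)))"

definition bid_prior :: "'b set \<Rightarrow> ('b \<Rightarrow> real) measure \<Rightarrow> bool" where
  "bid_prior S P \<longleftrightarrow>
     prob_space P \<and> sets P = sets (Pi\<^sub>M S (\<lambda>_. borel)) \<and> (AE b in P. \<forall>i\<in>S. 0 \<le> b i)"

text \<open>The value functions.  The argument \<open>H\<close> stands for the conditional expectations as functions of
  the conditioning value: \<open>H k B\<close> is the expectation of the value function number \<open>k-1\<close>, given that
  the low bids at \<open>k\<close> are \<open>B\<close>; see \<open>continuation\<close> below.\<close>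

fun dp_value ::
  "(real \<Rightarrow> (nat \<Rightarrow> real) \<Rightarrow> real) \<Rightarrow> (nat \<Rightarrow> (nat \<Rightarrow> real) \<Rightarrow> real) \<Rightarrow>
   (nat \<Rightarrow> (nat \<Rightarrow> real) \<Rightarrow> real) \<Rightarrow> nat \<Rightarrow> (nat \<Rightarrow> real) \<Rightarrow> real" where
  "dp_value M pr H 0 B = M (pr 0 B) B"
| "dp_value M pr H (Suc k) B = max (M (pr (Suc k) B) B) (H (Suc k) B)"

text \<open>\<open>H k\<close> is a version, as a Borel function of the low bids at \<open>k\<close>, of the conditional expectation
  of the value function number \<open>k-1\<close> given the low bids at \<open>k\<close>, under the prior \<open>P\<close>.  Such versions
  are unique only up to null sets; the oracle may use any of them.\<close>

definition continuation ::
  "nat \<Rightarrow> 'b set \<Rightarrow> ('b \<Rightarrow> real) measure \<Rightarrow> (real \<Rightarrow> (nat \<Rightarrow> real) \<Rightarrow> real) \<Rightarrow>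
   (nat \<Rightarrow> (nat \<Rightarrow> real) \<Rightarrow> real) \<Rightarrow> (nat \<Rightarrow> (nat \<Rightarrow> real) \<Rightarrow> real) \<Rightarrow> bool" where
  "continuation r S P M pr H \<longleftrightarrow>
     (\<forall>k\<in>{1..r}.
        let next_value = (\<lambda>b. dp_value M pr H (k - 1) (low_bids S b (k - 1)));
            F = vimage_algebra (space P) (\<lambda>b. low_bids S b k) (low_bids_space S k)
        in integrable P next_value \<and>
           H k \<in> borel_measurable (low_bids_space S k) \<and>
           (AE b in P. H k (low_bids S b k) = real_cond_exp P F next_value b))"

text \<open>The stopping index when the search is started at the last argument.\<close>

fun dp_stop ::
  "'b set \<Rightarrow> (real \<Rightarrow> (nat \<Rightarrow> real) \<Rightarrow> real) \<Rightarrow> (nat \<Rightarrow> (nat \<Rightarrow> real) \<Rightarrow> real) \<Rightarrow>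
   (nat \<Rightarrow> (nat \<Rightarrow> real) \<Rightarrow> real) \<Rightarrow> ('b \<Rightarrow> real) \<Rightarrow> nat \<Rightarrow> nat" where
  "dp_stop S M pr H b 0 = 0"
| "dp_stop S M pr H b (Suc k) =
     (let B = low_bids S b (Suc k)
      in if M (pr (Suc k) B) B < H (Suc k) B then dp_stop S M pr H b k else Suc k)"

definition dp_price ::
  "nat \<Rightarrow> 'b set \<Rightarrow> (real \<Rightarrow> (nat \<Rightarrow> real) \<Rightarrow> real) \<Rightarrow> (nat \<Rightarrow> (nat \<Rightarrow> real) \<Rightarrow> real) \<Rightarrow>
   (nat \<Rightarrow> (nat \<Rightarrow> real) \<Rightarrow> real) \<Rightarrow> ('b \<Rightarrow> real) \<Rightarrow> real" where
  "dp_price r S M pr H b =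
     (let k = dp_stop S M pr H b r in pr k (low_bids S b k))"


section \<open>The mechanism\<close>

definition draw_winners :: "nat \<Rightarrow> 'b set \<Rightarrow> 'b set pmf" where
  "draw_winners m Q =
     (if card Q > m then pmf_of_set {W. W \<subseteq> Q \<and> card W = m} else return_pmf Q)"

text \<open>The random set of winners for the predicted non-colluders \<open>S\<close>, the predicted colluders \<open>T\<close>, and
  the posted price \<open>p\<close>.  The subtraction of natural numbers is truncated at \<open>0\<close>.\<close>

definition cpop_winners ::
  "nat \<Rightarrow> 'b set \<Rightarrow> 'b set \<Rightarrow> real \<Rightarrow> ('b \<Rightarrow> real) \<Rightarrow> 'b set pmf" where
  "cpop_winners r S T p b =
     do {
       W1 \<leftarrow> draw_winners r {i \<in> S. p < b i};
       W2 \<leftarrow> draw_winners (r - card W1) {i \<in> T. p < b i};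
       return_pmf (W1 \<union> W2)
     }"

text \<open>An outcome consists of an allocation and a payment for each bidder.\<close>

type_synonym 'b outcome = "('b \<Rightarrow> real) \<times> ('b \<Rightarrow> real)"

definition cpop ::
  "nat \<Rightarrow> 'b set \<Rightarrow> 'b set \<Rightarrow> (real \<Rightarrow> (nat \<Rightarrow> real) \<Rightarrow> real) \<Rightarrow> (nat \<Rightarrow> (nat \<Rightarrow> real) \<Rightarrow> real) \<Rightarrow>
   (nat \<Rightarrow> (nat \<Rightarrow> real) \<Rightarrow> real) \<Rightarrow> ('b \<Rightarrow> real) \<Rightarrow> 'b outcome pmf" where
  "cpop r S T M pr H b =
     (let p = dp_price r S M pr H b
      in map_pmf (\<lambda>W. (\<lambda>i. if i \<in> W then 1 else 0, \<lambda>i. if i \<in> W then p else 0))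
           (cpop_winners r S T p b))"

definition expected_utility :: "'b outcome pmf \<Rightarrow> 'b \<Rightarrow> real \<Rightarrow> real" where
  "expected_utility X i v = measure_pmf.expectation X (\<lambda>(x, pay). v * x i - pay i)"

text \<open>Ex-post dominant strategy incentive compatibility of the mechanism \<open>mech\<close> for the bidders in \<open>N\<close>,
  where \<open>A\<close> is the set of all bidders.\<close>

definition dsic_for :: "'b set \<Rightarrow> 'b set \<Rightarrow> (('b \<Rightarrow> real) \<Rightarrow> 'b outcome pmf) \<Rightarrow> bool" where
  "dsic_for N A mech \<longleftrightarrow>
     (\<forall>i\<in>N. \<forall>v\<ge>0. \<forall>b. (\<forall>j\<in>A - {i}. 0 \<le> b j) \<longrightarrow>
        (\<forall>z\<ge>0. expected_utility (mech (b(i := z))) i v \<le> expected_utility (mech (b(i := v))) i v))"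

end

theory Submission
  imports Defs
begin

text \<open>A bidder wins only with a bid above the posted price, and that price is at least the bid of
  rank \<open>k\<^sup>* + 1\<close>.  Hence the low bids at every index \<open>k \<ge> k\<^sup>*\<close> do not change when a winning bid is
  replaced by any other bid above the price; the backward search stops at the same \<open>k\<^sup>*\<close> and posts the
  same price.  So a bidder faces a fixed price on all bids that could win, and truthful bidding is
  optimal regardless of how the bidder was classified.\<close>

text \<open>In a descending list the entries that reach \<open>t\<close> form a prefix, so their
  number decides which positions belong to it.\<close>

lemma le_nth_iff_length_filter:
  fixes xs :: "'a::linorder list"
  assumes "sorted_wrt (\<ge>) xs" and "n < length xs"
  shows "t \<le> xs ! n \<longleftrightarrow> n < length (filter (\<lambda>x. t \<le> x) xs)"
  using assms
proof (induction xs arbitrary: n)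
  case Nil
  then show ?case by simp
next
  case (Cons x xs)
  show ?case
  proof (cases "t \<le> x")
    case True
    then show ?thesis using Cons by (cases n) auto
  next
    case False
    with Cons.prems have "\<forall>y\<in>set (x # xs). \<not> t \<le> y"
      by (auto dest: order_trans)
    moreover from this have "filter (\<lambda>x. t \<le> x) (x # xs) = []"
      by (simp add: filter_empty_conv)
    ultimately show ?thesis
      using nth_mem[OF Cons.prems(2)] by (metis list.size(3) not_less_zero)
  qed
qed

text \<open>Trades sorted lists for counting: later comparisons of order statistics are made by
  choosing a threshold \<open>t\<close>. The bounds on \<open>k\<close> keep the default value 0 of
  \<open>kth_largest\<close> out of play.\<close>

lemma le_kth_largest_iff:
  assumes "finite S" and "1 \<le> k" and "k \<le> card S"
  shows "t \<le> kth_largest S b k \<longleftrightarrow> k \<le> card {i \<in> S. t \<le> b i}"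
proof -
  define xs where "xs = rev (sorted_list_of_multiset (image_mset b (mset_set S)))"
  have mset: "mset xs = image_mset b (mset_set S)"
    by (simp add: xs_def)
  have len: "length xs = card S"
    using arg_cong[OF mset, of size] by simp
  have sorted: "sorted_wrt (\<ge>) xs"
    by (simp add: xs_def sorted_wrt_rev)
  have "length (filter (\<lambda>x. t \<le> x) xs) = size (filter_mset (\<lambda>x. t \<le> x) (mset xs))"
    by (metis mset_filter size_mset)
  also have "\<dots> = card {i \<in> S. t \<le> b i}"
    using assms(1) by (simp add: mset filter_mset_image_mset)
  \<comment> \<open>Ranks start at 1, list positions at 0.\<close>
  finally show ?thesis
    using le_nth_iff_length_filter[OF sorted, of "k - 1" t] assms len
    by (auto simp: kth_largest_def xs_def)
qed

lemma kth_largest_antimono: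
  assumes "finite S" and "1 \<le> j" and "j \<le> k" and "k \<le> card S"
  shows "kth_largest S b k \<le> kth_largest S b j"
  using le_kth_largest_iff[of S k "kth_largest S b k" b]
    le_kth_largest_iff[of S j "kth_largest S b k" b] assms by simp

lemma kth_largest_mono_set:
  assumes "finite S" and "R \<subseteq> S" and "1 \<le> k" and "k \<le> card R"
  shows "kth_largest R b k \<le> kth_largest S b k"
proof -
  let ?t = "kth_largest R b k"
  have "k \<le> card {i \<in> R. ?t \<le> b i}"
    using le_kth_largest_iff[of R k ?t b] assms finite_subset by auto
  also have "\<dots> \<le> card {i \<in> S. ?t \<le> b i}"
    using assms by (intro card_mono) auto
  finally show ?thesis
    using le_kth_largest_iff[of S k ?t b] assms card_mono[of S R] by simp
qed

text \<open>For thresholds up to \<open>min x y\<close> the count of bids that reach them cannot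
  tell \<open>x\<close> from \<open>y\<close>. Both order statistics turn out to lie in this
  range.\<close>

lemma kth_largest_update_above:
  assumes "finite S" and "1 \<le> k" and "k \<le> card S"
    and le: "kth_largest S (b(i := x)) k \<le> c" and "c < x" and "c < y"
  shows "kth_largest S (b(i := y)) k = kth_largest S (b(i := x)) k"
proof (rule antisym)
  note iff = le_kth_largest_iff[OF assms(1-3)]
  have eq: "{j \<in> S. t \<le> (b(i := y)) j} = {j \<in> S. t \<le> (b(i := x)) j}"
    if "t \<le> min x y" for t
    using that by auto
  let ?u = "kth_largest S (b(i := x)) k"
  have "?u \<le> min x y"
    using assms by simp
  moreover have "k \<le> card {j \<in> S. ?u \<le> (b(i := x)) j}"
    using iff[of ?u "b(i := x)"] by blast
  ultimately show "?u \<le> kth_largest S (b(i := y)) k"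
    using iff[of ?u "b(i := y)"] eq[of ?u] by simp
  define t where "t = kth_largest S (b(i := y)) k"
  have k: "k \<le> card {j \<in> S. t \<le> (b(i := y)) j}"
    using iff[of t "b(i := y)"] by (simp add: t_def)
  \<comment> \<open>Otherwise the \<open>k\<close> bids that reach \<open>t\<close> after the update
    all reach \<open>min x y\<close> before it, bidder \<open>i\<close> because
    \<open>min x y \<le> x\<close>. The old order statistic would then exceed
    \<open>c\<close>.\<close>
  have "t \<le> min x y"
  proof (rule ccontr)
    assume "\<not> t \<le> min x y"
    then have "{j \<in> S. t \<le> (b(i := y)) j} \<subseteq> {j \<in> S. min x y \<le> (b(i := x)) j}"
      by auto
    then have "k \<le> card {j \<in> S. min x y \<le> (b(i := x)) j}"
      using k by (rule order_trans[OF _ card_mono, rotated 2]) (simp add: assms(1))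
    then have "min x y \<le> kth_largest S (b(i := x)) k"
      using iff by blast
    then show False using assms by linarith
  qed
  then show "t \<le> kth_largest S (b(i := x)) k"
    using k eq iff by simp
qed

text \<open>Every rank recorded at \<open>m\<close> is at least \<open>k + 1\<close>, so its bid is
  bounded by \<open>c\<close> as well.\<close>

lemma low_bids_update_above:
  assumes "finite S" and "k \<le> m"
    and "kth_largest S (b(i := x)) (k + 1) \<le> c" and "c < x" and "c < y"
  shows "low_bids S (b(i := y)) m = low_bids S (b(i := x)) m"
  unfolding low_bids_def
proof (rule restrict_ext)
  fix j assume j: "j \<in> {m<..card S}"
  then have "kth_largest S (b(i := x)) j \<le> c"
    using kth_largest_antimono[of S "k + 1" j "b(i := x)"] assms by auto
  then show "kth_largest S (b(i := y)) j = kth_largest S (b(i := x)) j"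
    using kth_largest_update_above[of S j b i x c y] assms j by auto
qed

lemma dp_stop_le: "dp_stop S M pr H b k \<le> k"
  by (induction k) (auto simp: Let_def intro: le_SucI)

text \<open>Each decision of the descending search reads only the low bids at the current index, and
  no index below the stopping one is visited.\<close>

lemma dp_stop_cong:
  assumes "\<And>m. dp_stop S M pr H b k \<le> m \<Longrightarrow> low_bids S b' m = low_bids S b m"
  shows "dp_stop S M pr H b' k = dp_stop S M pr H b k"
  using assms
proof (induction k)
  case 0
  then show ?case by simp
next
  case (Suc k)
  have eq: "low_bids S b' (Suc k) = low_bids S b (Suc k)"
    using Suc.prems dp_stop_le by blast
  then show ?case
    using Suc by (auto simp: Let_def split: if_splits)
qed

text \<open>This is the constraint of the maximization at the stopping index, which is at most
  \<open>r\<close> and hence covered by the price rule.\<close>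

lemma kth_largest_le_dp_price:
  assumes "price_rule r S M pr" and "\<forall>i\<in>S. 0 \<le> b i"
  shows "kth_largest S b (dp_stop S M pr H b r + 1) \<le> dp_price r S M pr H b"
  using assms dp_stop_le[of S M pr H b r]
  by (auto simp: price_rule_def dp_price_def is_arg_max_def Let_def)

lemma dp_price_update_above:
  assumes "finite S" and "price_rule r S M pr" and "\<forall>j\<in>S. 0 \<le> (b(i := x)) j"
    and "dp_price r S M pr H (b(i := x)) < x" and "dp_price r S M pr H (b(i := x)) < y"
  shows "dp_price r S M pr H (b(i := y)) = dp_price r S M pr H (b(i := x))"
proof -
  let ?k = "dp_stop S M pr H (b(i := x)) r"
  \<comment> \<open>The posted price itself serves as the separating value \<open>c\<close>.\<close>
  have low: "low_bids S (b(i := y)) m = low_bids S (b(i := x)) m" if "?k \<le> m" for m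
    using low_bids_update_above[OF assms(1) that kth_largest_le_dp_price[OF assms(2,3)]] assms
    by blast
  then have "dp_stop S M pr H (b(i := y)) r = ?k"
    by (rule dp_stop_cong)
  with low show ?thesis
    by (simp add: dp_price_def Let_def)
qed

lemma set_pmf_draw_winners:
  assumes "finite Q"
  shows "set_pmf (draw_winners m Q) \<subseteq> Pow Q"
proof (cases "m < card Q")
  case True
  \<comment> \<open>A witness is needed because the support of \<open>pmf_of_set\<close> is known
    only for nonempty finite sets.\<close>
  then obtain W where "W \<subseteq> Q" "card W = m"
    by (metis less_imp_le_nat obtain_subset_with_card_n)
  then have "{W. W \<subseteq> Q \<and> card W = m} \<noteq> {}" by blast
  then show ?thesis
    using True assms by (auto simp: draw_winners_def set_pmf_of_set)
qed (simp add: draw_winners_def)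

lemma cpop_winners_bid_above:
  assumes "finite S" and "finite T" and "W \<in> set_pmf (cpop_winners r S T p b)" and "i \<in> W"
  shows "p < b i"
proof -
  have fin: "finite {j \<in> S. p < b j}" "finite {j \<in> T. p < b j}"
    using assms by auto
  show ?thesis
    using assms(3,4) set_pmf_draw_winners[OF fin(1)] set_pmf_draw_winners[OF fin(2)]
    by (fastforce simp: cpop_winners_def)
qed

text \<open>Winning is worth \<open>v\<close> minus the price and losing is worth 0, so only the
  probability of winning is random.\<close>

lemma expected_utility_cpop:
  "expected_utility (cpop r S T M pr H b) i v =
    (v - dp_price r S M pr H b) *
      measure_pmf.prob (cpop_winners r S T (dp_price r S M pr H b) b) {W. i \<in> W}"
proof -
  let ?p = "dp_price r S M pr H b"
  have "expected_utility (cpop r S T M pr H b) i v =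
      measure_pmf.expectation (cpop_winners r S T ?p b) (\<lambda>W. (v - ?p) * indicator {W. i \<in> W} W)"
    unfolding expected_utility_def cpop_def Let_def integral_map_pmf
    by (rule Bochner_Integration.integral_cong) auto
  then show ?thesis by simp
qed

lemma expected_utility_cpop_low_bid:
  assumes "finite S" and "finite T" and "b i \<le> dp_price r S M pr H b"
  shows "expected_utility (cpop r S T M pr H b) i v = 0"
proof -
  have "measure_pmf.prob (cpop_winners r S T (dp_price r S M pr H b) b) {W. i \<in> W} = 0"
    using cpop_winners_bid_above[OF assms(1,2)] assms(3)
    by (fastforce simp: measure_pmf_zero_iff)
  then show ?thesis by (simp add: expected_utility_cpop)
qed

text \<open>Misclassified bidders need no separate argument, since stability of the price holds
  whether or not \<open>i\<close> lies in \<open>S\<close>.\<close>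

lemma dsic_for_cpop:
  fixes S T A :: "'b set"
  assumes fin: "finite S" "finite T" and rule: "price_rule r S M pr" and "S \<subseteq> A"
  shows "dsic_for N A (cpop r S T M pr H)"
  unfolding dsic_for_def
proof (intro ballI allI impI)
  fix i and v z :: real and b :: "'b \<Rightarrow> real"
  assume v: "0 \<le> v" and b: "\<forall>j\<in>A - {i}. 0 \<le> b j" and z: "0 \<le> z"
  let ?U = "\<lambda>x. expected_utility (cpop r S T M pr H (b(i := x))) i v"
  let ?p = "\<lambda>x. dp_price r S M pr H (b(i := x))"
  have truthful: "0 \<le> ?U v"
  proof (cases "v \<le> ?p v")
    case True
    then show ?thesis using expected_utility_cpop_low_bid[OF fin] by simp
  qed (simp add: expected_utility_cpop)
  \<comment> \<open>Either \<open>z\<close> loses, or winning at the price for \<open>z\<close>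
    brings no gain, or both bids exceed that price and lead to the same lottery.\<close>
  consider "z \<le> ?p z" | "v \<le> ?p z" | "?p z < z" "?p z < v" by linarith
  then show "?U z \<le> ?U v"
  proof cases
    case 1
    then have "?U z = 0" using expected_utility_cpop_low_bid[OF fin] by simp
    with truthful show ?thesis by simp
  next
    case 2
    then have "?U z \<le> 0" by (simp add: expected_utility_cpop mult_nonpos_nonneg)
    with truthful show ?thesis by linarith
  next
    case 3
    have "\<forall>j\<in>S. 0 \<le> (b(i := z)) j"
      using b z \<open>S \<subseteq> A\<close> by auto
    then have p: "?p v = ?p z"
      using dp_price_update_above[OF fin(1) rule _ 3] by blast
    \<comment> \<open>Bids matter to the draw only through who qualifies; \<open>R\<close> stands
      for the pool of either phase.\<close>
    have "{j \<in> R. ?p z < (b(i := v)) j} = {j \<in> R. ?p z < (b(i := z)) j}" for R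
      using 3 by auto
    then have "cpop_winners r S T (?p z) (b(i := v)) = cpop_winners r S T (?p z) (b(i := z))"
      by (simp only: cpop_winners_def)
    with p show ?thesis by (simp add: expected_utility_cpop)
  qed
qed

theorem proposition4p4:
  fixes r :: nat
    and N C N\<^sub>T N\<^sub>F C\<^sub>T C\<^sub>F Nhat Chat :: "'b set"
    and M :: "real \<Rightarrow> (nat \<Rightarrow> real) \<Rightarrow> real"
    and pr H :: "nat \<Rightarrow> (nat \<Rightarrow> real) \<Rightarrow> real"
    and P :: "('b \<Rightarrow> real) measure"
  assumes "finite N" and "finite C" and "N \<inter> C = {}"
    and "N = N\<^sub>T \<union> N\<^sub>F" and "N\<^sub>T \<inter> N\<^sub>F = {}"
    and "C = C\<^sub>T \<union> C\<^sub>F" and "C\<^sub>T \<inter> C\<^sub>F = {}"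
    and "Nhat = N\<^sub>T \<union> C\<^sub>F" and "Chat = N\<^sub>F \<union> C\<^sub>T"
    and "price_rule r Nhat M pr"
    and "bid_prior Nhat P"
    and "continuation r Nhat P M pr H"
  shows "dsic_for N (N \<union> C) (cpop r Nhat Chat M pr H) \<and>
    (card N\<^sub>T \<ge> r + 1 \<longrightarrow>
      (\<forall>b. (\<forall>i\<in>N \<union> C. 0 \<le> b i) \<longrightarrow>
        dp_price r Nhat M pr H b \<ge> kth_largest N\<^sub>T b (r + 1)))"
proof (intro conjI impI allI)
  have fin: "finite Nhat" "finite Chat" and sub: "Nhat \<subseteq> N \<union> C"
    using assms by auto
  show "dsic_for N (N \<union> C) (cpop r Nhat Chat M pr H)"
    using dsic_for_cpop[OF fin \<open>price_rule r Nhat M pr\<close> sub] .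
  fix b :: "'b \<Rightarrow> real"
  assume card: "r + 1 \<le> card N\<^sub>T" and b: "\<forall>i\<in>N \<union> C. 0 \<le> b i"
  let ?k = "dp_stop Nhat M pr H b r"
  have "N\<^sub>T \<subseteq> Nhat"
    using assms by auto
  \<comment> \<open>Adding the misclassified colluders can only raise the bid at rank
    \<open>r + 1\<close>, and stopping at \<open>?k \<le> r\<close> moves to a rank with a bid at
    least as large. The bound on \<open>card N\<^sub>T\<close> makes all these ranks
    genuine.\<close>
  then have "kth_largest N\<^sub>T b (r + 1) \<le> kth_largest Nhat b (r + 1)"
    using kth_largest_mono_set[OF fin(1)] card by simp
  also have "\<dots> \<le> kth_largest Nhat b (?k + 1)"
    using kth_largest_antimono[OF fin(1), of "?k + 1" "r + 1"] dp_stop_le[of Nhat M pr H b r]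
      card card_mono[OF fin(1) \<open>N\<^sub>T \<subseteq> Nhat\<close>] by simp
  also have "\<dots> \<le> dp_price r Nhat M pr H b"
    using kth_largest_le_dp_price[OF \<open>price_rule r Nhat M pr\<close>] b sub by blast
  finally show "kth_largest N\<^sub>T b (r + 1) \<le> dp_price r Nhat M pr H b" .
qed

end
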